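(* Let $s\in(0,\tfrac18)$, $a=1-\sqrt{2s}\in(\tfrac12,1)$, and $\bar r(a)=\frac{1-2a+\sqrt{4a^2-4a+9}}{4}$. For $r\in[0,1]$ let $\pi_1,\pi_2$ denote the profits of the prominent firm (Firm 1) and the non-prominent firm (Firm 2) at the equilibrium prices. Then: 1. For every $r\in[0,(1-a)^2]$, $\pi_1>\pi_2$. 2. There exists $\hat r(a)\in\left((1-a)^2,\bar r(a)\right)$ such that for every $r\in(\hat r(a),\bar r(a)]$, $\pi_1<\pi_2$.
   Context: Two firms sell one product each at zero marginal cost. Consumers (unit mass) have match values $u_1,u_2$, i.i.d. uniform on $[0,1]$. Firm 1 is prominent (searched and bought first, at no search cost); searching and buying product 2 costs $s\in(0,1/8)$; returned units are fully refunded and cost the firm $r$ each. Prices are not observed before search, so search decisions depend on the actual $p_1$ and the expected (equilibrium) price $p_2$: with $a=1-\sqrt{2s}$, a consumer buys product 2 iff $u_1<a+p_1-p_2$. Given a candidate pair $(p_1,p_2)$, the deviation profits are as follows. If Firm 1 charges $p$ instead of $p_1$, $$\pi_1(p)=(p+r)\Big[1-(a+p-p_2)+\tfrac12(a^2-p_2^2)\Big]-r .$$ If Firm 2 charges $p$ instead of $p_2$ (consumers still expect $p_2$ when deciding whether to search), $$\pi_2(p)=(p+r)\Big[(a+p_1-p_2)\big(1-(a+p-p_2)\big)+\tfrac12(a-p_2)(a-p_2+2p_1)\Big]-r(a+p_1-p_2).$$ A pair $(p_1,p_2)$ of nonnegative prices is an equilibrium if $p_1$ maximizes $\pi_1(\cdot)$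 over $p\ge0$ and $p_2$ maximizes $\pi_2(\cdot)$ over $p\ge 0$. For each $r\in[0,1]$ the paper shows there is exactly one equilibrium with $p_1,p_2\in[0,\frac{1-r}{2}]$; this is "the" equilibrium. Equilibrium profits are $\pi_1=\pi_1(p_1)$ and $\pi_2=\pi_2(p_2)$ evaluated at it. *)

theory Defs
  imports Complex_Main
begin

(* Parameters: a = 1 - sqrt (2 * s) is determined by the search cost s, and r is a firm's cost
   per returned unit. The last argument p is the price actually charged by the firm.

   In deviation_profit1 the candidate price of Firm 1 itself does not occur: Firm 1's actual
   price is observed before the search decision. In deviation_profit2 the candidate price p2 of
   Firm 2 still occurs: consumers decide whether to search on the basis of the expected price
   p2, not of the price p charged. *)

definition deviation_profit1 :: "real \<Rightarrow> real \<Rightarrow> real \<Rightarrow> real \<Rightarrow> real" where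
  "deviation_profit1 a r p2 p =
     (p + r) * (1 - (a + p - p2) + (a\<^sup>2 - p2\<^sup>2) / 2) - r"

definition deviation_profit2 :: "real \<Rightarrow> real \<Rightarrow> real \<Rightarrow> real \<Rightarrow> real \<Rightarrow> real" where
  "deviation_profit2 a r p1 p2 p =
     (p + r) * ((a + p1 - p2) * (1 - (a + p - p2)) + (a - p2) * (a - p2 + 2 * p1) / 2)
       - r * (a + p1 - p2)"

definition is_equilibrium :: "real \<Rightarrow> real \<Rightarrow> real \<Rightarrow> real \<Rightarrow> bool" where
  "is_equilibrium a r p1 p2 \<longleftrightarrow>
     is_arg_max (deviation_profit1 a r p2) (\<lambda>p. p \<ge> 0) p1 \<and>
     is_arg_max (deviation_profit2 a r p1 p2) (\<lambda>p. p \<ge> 0) p2"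

(* A definite description: it is meaningful only when there is exactly one equilibrium with
   both prices in the given interval. *)
definition equilibrium_prices :: "real \<Rightarrow> real \<Rightarrow> real \<times> real" where
  "equilibrium_prices a r =
     (THE (p1, p2). is_equilibrium a r p1 p2 \<and>
        p1 \<in> {0..(1 - r) / 2} \<and> p2 \<in> {0..(1 - r) / 2})"

definition equilibrium_profit1 :: "real \<Rightarrow> real \<Rightarrow> real" where
  "equilibrium_profit1 a r =
     (let (p1, p2) = equilibrium_prices a r in deviation_profit1 a r p2 p1)"

definition equilibrium_profit2 :: "real \<Rightarrow> real \<Rightarrow> real" where
  "equilibrium_profit2 a r =
     (let (p1, p2) = equilibrium_prices a r in deviation_profit2 a r p1 p2 p2)"

definition r_bar :: "real \<Rightarrow> real" where
  "r_bar a = (1 - 2 * a + sqrt (4 * a\<^sup>2 - 4 * a + 9)) / 4"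

end

theory Submission
  imports Defs
begin

text \<open>
  Both deviation profits are strictly concave quadratics in the own price, so an equilibrium is a
  fixed point of two best responses. The response of Firm 1 has slope at most 1/2 in p2, and
  the consistent price of Firm 2 has slope at most 1/3 in p1, whence uniqueness.

  For r at most (1 - a)^2 the equilibrium is interior with p1 < p2. Firm 1 could charge p2
  instead of p1, and the resulting profit already exceeds that of Firm 2 because
  p2 + r > 1 - a.

  Near r_bar the equilibrium is the corner p1 = 0, p2 = (2 - a - 2 r) / 3. At r = r_bar the
  defining quadratic of r_bar becomes a - a^2 = 9 p2 - 9 p2^2, which leaves slack in the corner
  condition for p1; so the corner persists slightly to the left of r_bar, and there the profits can
  be compared directly.
\<close>

section \<open>Best responses\<close>

text \<open>Two values differ by \<open>c\<close> times the difference of the squared distances to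
  the vertex \<open>m\<close>, so the maximizer is the point of the half-line nearest to
  \<open>m\<close>.\<close>

lemma is_arg_max_quadratic_nonneg:
  fixes K c d r x :: real
  assumes "c > 0"
  shows "is_arg_max (\<lambda>p. (p + r) * (K - c * p) - d) (\<lambda>p. p \<ge> 0) x
    \<longleftrightarrow> x = max 0 ((K / c - r) / 2)"
proof -
  define m where "m = (K / c - r) / 2"
  have K: "K = c * (2 * m + r)"
    using assms by (simp add: m_def field_simps)
  have diff: "((p + r) * (K - c * p) - d) - ((p' + r) * (K - c * p') - d)
      = c * ((p' - m)\<^sup>2 - (p - m)\<^sup>2)" for p p'
    unfolding K by (simp add: algebra_simps power2_eq_square)
  have less_iff: "(p' + r) * (K - c * p') - d < (p + r) * (K - c * p) - d
      \<longleftrightarrow> \<bar>p - m\<bar> < \<bar>p' - m\<bar>" for p p'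
    using diff[of p p'] assms abs_le_square_iff[of "p' - m" "p - m"]
    by (smt (verit) zero_less_mult_iff)
  show ?thesis
    unfolding is_arg_max_def less_iff m_def[symmetric]
  proof
    assume x: "x \<ge> 0 \<and> (\<nexists>p. p \<ge> 0 \<and> \<bar>p - m\<bar> < \<bar>x - m\<bar>)"
    then have "\<not> \<bar>max 0 m - m\<bar> < \<bar>x - m\<bar>"
      by (metis max.cobounded1)
    with x show "x = max 0 m"
      by (auto simp: max_def split: if_splits)
  qed (auto simp: max_def)
qed

definition response1 :: "real \<Rightarrow> real \<Rightarrow> real \<Rightarrow> real" where
  "response1 a r y = max 0 ((1 - a + y + (a\<^sup>2 - y\<^sup>2) / 2 - r) / 2)"

text \<open>
  With b = a - p2 and x = p1, this is the fraction of the consumers searching product 2 who buy it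
  with a match value below a + p - p2; it does not depend on the price p actually charged.
\<close>
definition low_match_share :: "real \<Rightarrow> real \<Rightarrow> real" where
  "low_match_share x b = b * (b + 2 * x) / (2 * (b + x))"

text \<open>The argument \<open>y\<close> is the price that consumers expect from Firm 2 and the
  value is its best actual price; an equilibrium makes the two coincide.\<close>

definition response2 :: "real \<Rightarrow> real \<Rightarrow> real \<Rightarrow> real \<Rightarrow> real" where
  "response2 a r x y = max 0 ((1 - a + y + low_match_share x (a - y) - r) / 2)"

lemma is_equilibrium_iff:
  assumes "a + x - y > 0"
  shows "is_equilibrium a r x y \<longleftrightarrow> x = response1 a r y \<and> y = response2 a r x y"
proof -
  have 1: "deviation_profit1 a r y
      = (\<lambda>p. (p + r) * ((1 - a + y + (a\<^sup>2 - y\<^sup>2) / 2) - 1 * p) - r)"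
    by (auto simp: deviation_profit1_def fun_eq_iff algebra_simps)
  let ?q = "a + x - y"
  let ?K = "?q * (1 - a + y) + (a - y) * (a - y + 2 * x) / 2"
  have 2: "deviation_profit2 a r x y = (\<lambda>p. (p + r) * (?K - ?q * p) - r * ?q)"
    by (auto simp: deviation_profit2_def fun_eq_iff field_simps)
  have "(q * c + e / 2) / q = c + e / (2 * q)" if "q > 0" for q c e :: real
    using that by (simp add: field_simps)
  moreover have "a - y + x = ?q"
    by simp
  ultimately have "?K / ?q = 1 - a + y + low_match_share x (a - y)"
    using assms by (simp only: low_match_share_def)
  then show ?thesis
    unfolding is_equilibrium_def 1 2 response1_def response2_def
    using is_arg_max_quadratic_nonneg[of 1] is_arg_max_quadratic_nonneg[OF assms] by simp
qed

section \<open>Monotonicity and Lipschitz estimates\<close>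

text \<open>The first form exposes the dependence on \<open>x\<close> for fixed \<open>b\<close>,
  the second the growth in \<open>b\<close> for fixed \<open>x\<close>.\<close>

lemma low_match_share_alt:
  assumes "b + x > 0"
  shows "low_match_share x b = b - b\<^sup>2 / (2 * (b + x))"
    and "low_match_share x b = (b + x - x\<^sup>2 / (b + x)) / 2"
  using assms by (simp_all add: low_match_share_def field_simps power2_eq_square)

lemma low_match_share_mono:
  assumes "0 \<le> x" "0 < b" "b \<le> b'"
  shows "low_match_share x b \<le> low_match_share x b'"
proof -
  have "x\<^sup>2 / (b' + x) \<le> x\<^sup>2 / (b + x)"
    using assms by (intro divide_left_mono) auto
  moreover have "low_match_share x b = (b + x - x\<^sup>2 / (b + x)) / 2"
    "low_match_share x b' = (b' + x - x\<^sup>2 / (b' + x)) / 2"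
    using assms by (simp_all add: low_match_share_alt(2))
  ultimately show ?thesis
    using assms by (auto intro!: divide_right_mono diff_mono)
qed

lemma low_match_share_lipschitz:
  assumes "0 \<le> x" "x \<le> x'" "0 < b"
  shows "low_match_share x' b - low_match_share x b \<le> (x' - x) / 2"
proof -
  have "b\<^sup>2 \<le> (b + x) * (b + x')"
    unfolding power2_eq_square using assms by (intro mult_mono) auto
  then have "(x' - x) * (b\<^sup>2 / ((b + x) * (b + x'))) \<le> (x' - x) * 1"
    using assms by (intro mult_left_mono) (simp_all add: divide_le_eq)
  moreover have "low_match_share x' b - low_match_share x b
      = (x' - x) * (b\<^sup>2 / ((b + x) * (b + x'))) / 2"
  proof -
    have "b\<^sup>2 / (2 * A) - b\<^sup>2 / (2 * B) = (B - A) * (b\<^sup>2 / (A * B)) / 2"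
      if "A > 0" "B > 0" for A B :: real
      using that by (simp add: field_simps)
    from this[of "b + x" "b + x'"] show ?thesis
      using assms by (simp add: low_match_share_alt(1))
  qed
  ultimately show ?thesis
    by simp
qed

lemma low_match_share_bounds:
  assumes "0 \<le> x" "0 < b"
  shows "b / 2 \<le> low_match_share x b" and "low_match_share x b \<le> b"
  using assms by (simp_all add: low_match_share_def field_simps)

lemma response1_increment:
  assumes "0 \<le> y" "y \<le> y'" "y' \<le> 1 / 2"
  shows "response1 a r y \<le> response1 a r y'"
    and "response1 a r y' - response1 a r y \<le> (y' - y) / 2"
proof -
  define f where "f y = (1 - a + y + (a\<^sup>2 - y\<^sup>2) / 2 - r) / 2" for y
  have eq: "f y' - f y = (y' - y) * (1 - (y + y') / 2) / 2"
    by (simp add: f_def field_simps power2_eq_square)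
  \<comment> \<open>The difference quotient of \<open>f\<close> lies in [0, 1/2]; truncation at 0
    preserves both bounds.\<close>
  have "(y' - y) * (1 - (y + y') / 2) \<ge> 0"
    using assms by (intro mult_nonneg_nonneg) auto
  moreover have "(y' - y) * (1 - (y + y') / 2) \<le> (y' - y) * 1"
    using assms by (intro mult_left_mono) auto
  ultimately have "f y \<le> f y'" "f y' - f y \<le> (y' - y) / 2"
    using eq by simp_all
  then show "response1 a r y \<le> response1 a r y'"
    and "response1 a r y' - response1 a r y \<le> (y' - y) / 2"
    using assms unfolding response1_def f_def[symmetric] by auto
qed

section \<open>Uniqueness and existence of the equilibrium\<close>

text \<open>With D = y' - y, subtracting the fixed point relations gives 2 D \<le> D + (x' - x) / 2
  \<le> D + D / 4, which is impossible for D > 0.\<close>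

lemma no_two_fixed_points:
  assumes a: "1 / 2 < a" and y: "0 \<le> y" "y < y'" "y' \<le> 1 / 2"
    and fp: "y = response2 a r (response1 a r y) y"
    and fp': "y' = response2 a r (response1 a r y') y'"
  shows False
proof -
  define x x' where "x = response1 a r y" and "x' = response1 a r y'"
  have x: "0 \<le> x" "x \<le> x'" "x' - x \<le> (y' - y) / 2"
    using response1_increment[of y y' a r] y
    by (auto simp: x_def x'_def) (simp add: response1_def)
  \<comment> \<open>Only an inequality holds here, since \<open>y\<close> may be 0 by truncation;
    \<open>y'\<close> is positive, so its equation is exact.\<close>
  have "2 * y \<ge> 1 - a + y + low_match_share x (a - y) - r"
    using fp by (auto simp: response2_def x_def max_def split: if_splits)
  moreover have "2 * y' = 1 - a + y' + low_match_share x' (a - y') - r"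
    using fp' y by (auto simp: response2_def x'_def max_def split: if_splits)
  moreover have "low_match_share x' (a - y') \<le> low_match_share x' (a - y)"
    using x y a by (intro low_match_share_mono) auto
  moreover have "low_match_share x' (a - y) - low_match_share x (a - y) \<le> (x' - x) / 2"
    using x y a by (intro low_match_share_lipschitz) auto
  ultimately show False
    using x y by (simp add: field_simps)
qed

lemma equilibrium_prices_eqI:
  assumes a: "1 / 2 < a" "a < 1" and r: "0 \<le> r" "r \<le> 1"
    and y: "0 \<le> y" "y \<le> (1 - r) / 2"
    and x: "x = response1 a r y" and fp: "y = response2 a r x y"
  shows "equilibrium_prices a r = (x, y)"
proof -
  let ?P = "\<lambda>(p1, p2). is_equilibrium a r p1 p2 \<and>
        p1 \<in> {0..(1 - r) / 2} \<and> p2 \<in> {0..(1 - r) / 2}"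
  have x0: "0 \<le> x"
    by (simp add: x response1_def)
  \<comment> \<open>This bounds the untruncated response of Firm 1 by (1 - r) / 2.\<close>
  have "(a - y) * (a + y) \<le> (a - y) * 2"
    using a r y by (intro mult_left_mono) auto
  then have x1: "x \<le> (1 - r) / 2"
    using a r y by (auto simp: x response1_def max_def power2_eq_square field_simps)
  have "is_equilibrium a r x y"
    using is_equilibrium_iff[of a x y r] x fp x0 a r y by auto
  with x0 x1 y have "?P (x, y)"
    by simp
  moreover have "z = (x, y)" if "?P z" for z
  proof -
    obtain x' y' where z: "z = (x', y')"
      by force
    with that have xy': "is_equilibrium a r x' y'" "0 \<le> x'" "0 \<le> y'" "y' \<le> (1 - r) / 2"
      by auto
    then have fp': "x' = response1 a r y'" "y' = response2 a r x' y'"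
      using is_equilibrium_iff[of a x' y' r] a r by auto
    have "\<not> y < y'" "\<not> y' < y"
      using no_two_fixed_points[of a y y' r] no_two_fixed_points[of a y' y r]
        a r y xy' x fp fp' by auto
    then show ?thesis
      using z x fp' by simp
  qed
  ultimately show ?thesis
    unfolding equilibrium_prices_def by (rule the_equality)
qed

lemma fixed_point_exists:
  assumes a: "1 / 2 < a" "a < 1" and r: "0 \<le> r" "r \<le> 1"
  obtains y where "0 \<le> y" "y \<le> (1 - r) / 2" "y = response2 a r (response1 a r y) y"
proof -
  let ?f = "\<lambda>y. y - response2 a r (response1 a r y) y"
  have x0: "0 \<le> response1 a r y" for y
    by (simp add: response1_def)
  have nz: "2 * (a - y + response1 a r y) \<noteq> 0" if "y \<in> {0..(1 - r) / 2}" for y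
    using that x0[of y] a r by auto
  have "continuous_on {0..(1 - r) / 2} (response1 a r)"
    unfolding response1_def by (intro continuous_intros) auto
  then have "continuous_on {0..(1 - r) / 2} ?f"
    using nz unfolding response2_def low_match_share_def
    by (intro continuous_intros) auto
  moreover have "?f 0 \<le> 0"
    by (simp add: response2_def)
  \<comment> \<open>A share of at most \<open>a - y\<close> makes the response at most (1 - r) /
    2.\<close>
  moreover have "0 \<le> ?f ((1 - r) / 2)"
    using low_match_share_bounds(2)[OF x0, of "a - (1 - r) / 2" "(1 - r) / 2"] a r
    by (simp add: response2_def max_def field_simps)
  ultimately obtain y where "0 \<le> y" "y \<le> (1 - r) / 2" "?f y = 0"
    using IVT'[of ?f 0 0 "(1 - r) / 2"] r by auto
  then show ?thesis
    using that by simp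
qed

section \<open>Interior equilibrium for small r\<close>

text \<open>If x = y + d with d \<ge> 0, comparing the first-order conditions and cancelling a - y
  gives a + y + 2 d \<le> (a + y) (a + d), against a + y \<le> 2 and a < 1.\<close>

lemma price1_less_price2:
  assumes a: "0 < a" "a < 1" and y: "0 \<le> y" "y < a" "y \<le> 1" and "0 \<le> x"
    and x: "2 * x = 1 - a + y + (a\<^sup>2 - y\<^sup>2) / 2 - r"
    and y2: "2 * y = 1 - a + y + low_match_share x (a - y) - r"
  shows "x < y"
proof (rule ccontr)
  assume "\<not> x < y"
  define d where "d = x - y"
  have d: "d \<ge> 0" "x = y + d"
    using \<open>\<not> x < y\<close> by (auto simp: d_def)
  have "low_match_share x (a - y) \<le> (a\<^sup>2 - y\<^sup>2) / 2"
    using x y2 d by linarith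
  then have "(a - y) * (a + y + 2 * d) \<le> (a - y) * ((a + y) * (a + d))"
    using a d by (simp add: low_match_share_def field_simps power2_eq_square)
  then have "a + y + 2 * d \<le> (a + y) * (a + d)"
    using y by simp
  moreover have "(a + y) * d \<le> 2 * d" "(a + y) * a < (a + y) * 1"
    using a y d by (auto intro: mult_right_mono)
  ultimately show False
    by (simp add: algebra_simps)
qed

lemma profit1_greater:
  assumes a: "1 / 2 < a" "a < 1" and r: "0 \<le> r" "r \<le> (1 - a)\<^sup>2"
  shows "equilibrium_profit1 a r > equilibrium_profit2 a r"
proof -
  have "(1 - a)\<^sup>2 \<le> (1 / 2)\<^sup>2"
    using a by (intro power_mono) auto
  then have r4: "r \<le> 1 / 4"
    using r by (simp add: power2_eq_square)
  obtain y where y: "0 \<le> y" "y \<le> (1 - r) / 2" and fp: "y = response2 a r (response1 a r y) y"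
    using fixed_point_exists[of a r] a r r4 by auto
  define x where "x = response1 a r y"
  have x0: "0 \<le> x"
    by (simp add: x_def response1_def)
  have prices: "equilibrium_prices a r = (x, y)"
    using equilibrium_prices_eqI[of a r y x] a r r4 y fp by (simp add: x_def)
  have ya: "y < a"
    using y a r by simp
  \<comment> \<open>The bound on \<open>r\<close> gives 1 - a - r \<ge> a - a^2 \<ge> 0, so Firm 1's
    response is not truncated.\<close>
  have "y * y \<le> y * 1" "a * a \<le> a * 1"
    using y a r by (intro mult_left_mono; simp)+
  then have "1 - a + y + (a\<^sup>2 - y\<^sup>2) / 2 - r \<ge> 0"
    using r y a by (simp add: power2_eq_square field_simps)
  then have foc1: "2 * x = 1 - a + y + (a\<^sup>2 - y\<^sup>2) / 2 - r"
    by (simp add: x_def response1_def)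
  \<comment> \<open>Inserted in the condition for \<open>y\<close>, this yields y + r \<ge> (2 - a +
    r) / 3, which exceeds 1 - a because a > 1/2.\<close>
  have "low_match_share x (a - y) \<ge> (a - y) / 2"
    using low_match_share_bounds(1)[of x "a - y"] x0 ya by simp
  then have foc2: "2 * y = 1 - a + y + low_match_share x (a - y) - r"
    and yr: "y + r > 1 - a"
    using fp[folded x_def] r4 a ya y by (auto simp: response2_def max_def split: if_splits)
  have xy: "x < y"
    using price1_less_price2[of a y x r] a y ya r x0 foc1 foc2 by auto
  define q where "q = a + x - y"
  have q: "q < 1"
    using xy a by (simp add: q_def)
  have "(1 - a) * (1 - a) < (y + r) * (1 - a)"
    using yr a by (intro mult_strict_right_mono) auto
  then have "r < (y + r) * (1 - a)"
    using r by (simp add: power2_eq_square)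
  then have "0 < (1 - q) * ((y + r) * (1 - a) - r)"
    using q by simp
  moreover have "0 \<le> (y + r) * ((a - y) * (y - x))"
    using y r ya xy by (intro mult_nonneg_nonneg) auto
  moreover have "deviation_profit1 a r y y - deviation_profit2 a r x y y
      = (1 - q) * ((y + r) * (1 - a) - r) + (y + r) * ((a - y) * (y - x))"
    by (simp add: deviation_profit1_def deviation_profit2_def q_def field_simps power2_eq_square)
  moreover have "deviation_profit1 a r y x \<ge> deviation_profit1 a r y y"
  proof -
    have "is_equilibrium a r x y"
      using is_equilibrium_iff[of a x y r] x0 ya fp x_def by auto
    then show ?thesis
      using y by (auto simp: is_equilibrium_def is_arg_max_def not_less)
  qed
  ultimately show ?thesis
    by (simp add: equilibrium_profit1_def equilibrium_profit2_def prices)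
qed

section \<open>Corner equilibrium near r_bar\<close>

text \<open>At p1 = 0 the share is (a - y) / 2, which turns Firm 2's condition into the linear
  equation for \<open>y\<close>; \<open>corner\<close> then says that Firm 1's vertex is at most
  0.\<close>

lemma profit1_less_corner:
  assumes a: "1 / 2 < a" "a < 1" and r: "1 / 2 < r" "r \<le> 1"
    and y: "0 < y" "3 * y = 2 - a - 2 * r"
    and corner: "5 * y - y\<^sup>2 \<le> a - a\<^sup>2"
  shows "equilibrium_profit1 a r < equilibrium_profit2 a r"
proof -
  have ya: "y < a" and y1: "y \<le> (1 - r) / 2"
    using a r y by (simp_all add: field_simps)
  have reqv: "r = (2 - a - 3 * y) / 2"
    using y by simp
  have x: "0 = response1 a r y"
    using corner by (simp add: response1_def reqv max_def field_simps)
  have ratio: "low_match_share 0 b = b / 2" for b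
    by (simp add: low_match_share_def)
  have fp: "y = response2 a r 0 y"
    using y by (simp add: response2_def ratio field_simps)
  have prices: "equilibrium_prices a r = (0, y)"
    using equilibrium_prices_eqI[of a r y 0] a r y y1 x fp by simp
  have "r * ((a + y) / 2) < r * (r + 2 * y)"
    using a r y by (intro mult_strict_left_mono) auto
  also have "\<dots> \<le> (y + r)\<^sup>2"
    by (simp add: power2_eq_square algebra_simps)
  finally have "(a - y) * (r * ((a + y) / 2)) < (a - y) * (y + r)\<^sup>2"
    using ya by (intro mult_strict_left_mono) auto
  moreover have "deviation_profit2 a r 0 y y - deviation_profit1 a r y 0
      = (a - y) * (y + r)\<^sup>2 - (a - y) * (r * ((a + y) / 2))"
    unfolding deviation_profit1_def deviation_profit2_def reqv
    by (simp add: field_simps power2_eq_square)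
  ultimately show ?thesis
    by (simp add: equilibrium_profit1_def equilibrium_profit2_def prices)
qed

lemma r_bar_root:
  assumes "1 / 2 < a"
  shows "2 * (r_bar a)\<^sup>2 + (2 * a - 1) * r_bar a = 1"
proof -
  have "0 \<le> (2 * a - 1)\<^sup>2"
    by simp
  then have "0 \<le> 4 * a\<^sup>2 - 4 * a + 9"
    by (simp add: power2_eq_square algebra_simps)
  moreover have "4 * r_bar a - (1 - 2 * a) = sqrt (4 * a\<^sup>2 - 4 * a + 9)"
    by (simp add: r_bar_def field_simps)
  ultimately have "(4 * r_bar a - (1 - 2 * a))\<^sup>2 = 4 * a\<^sup>2 - 4 * a + 9"
    by simp
  then show ?thesis
    by (simp add: power2_eq_square algebra_simps)
qed

lemma r_bar_greater_half:
  assumes "1 / 2 < a" "a < 1"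
  shows "1 / 2 < r_bar a"
proof -
  have "(1 + 2 * a)\<^sup>2 < 4 * a\<^sup>2 - 4 * a + 9"
    using assms by (simp add: power2_eq_square algebra_simps)
  then have "1 + 2 * a < sqrt (4 * a\<^sup>2 - 4 * a + 9)"
    by (rule real_less_rsqrt)
  then show ?thesis
    by (simp add: r_bar_def)
qed

lemma profit1_less_near_r_bar:
  assumes a: "1 / 2 < a" "a < 1"
  shows "\<exists>r_hat \<in> {(1 - a)\<^sup>2<..<r_bar a}.
       \<forall>r \<in> {r_hat<..r_bar a}. equilibrium_profit1 a r < equilibrium_profit2 a r"
proof -
  \<comment> \<open>Firm 2's corner price at \<open>r_bar a\<close>.\<close>
  define z where "z = (2 - a - 2 * r_bar a) / 3"
  have rb: "r_bar a = (2 - a - 3 * z) / 2"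
    by (simp add: z_def field_simps)
  have root: "a - a\<^sup>2 = 9 * z - 9 * z\<^sup>2"
    using r_bar_root[OF a(1)] unfolding rb by (simp add: field_simps power2_eq_square)
  have half: "1 / 2 < r_bar a"
    by (rule r_bar_greater_half[OF a])
  have z1: "z < 1 / 2"
    using half a by (simp add: z_def)
  have "0 < a * (1 - a)"
    using a by simp
  also have "a * (1 - a) = 9 * (z * (1 - z))"
    using root by (simp add: power2_eq_square algebra_simps)
  finally have z0: "0 < z"
    using z1 by (simp add: zero_less_mult_iff)
  \<comment> \<open>By \<open>root\<close>, this is the slack a - a^2 - (5 z - z^2) in the corner
    condition.\<close>
  define c where "c = 4 * z * (1 - 2 * z)"
  have c0: "0 < c"
    using z0 z1 by (simp add: c_def)
  \<comment> \<open>At \<open>r\<close> the corner price is z + d with d = 2 (r_bar - r) / 3, which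
    costs at most 5 d of the slack; the second bound ensures 5 d < c.\<close>
  define r_hat where "r_hat = max (1 / 2) (r_bar a - 3 * c / 10)"
  have "(1 - a)\<^sup>2 < (1 / 2)\<^sup>2"
    using a by (intro power_strict_mono) auto
  then have "r_hat \<in> {(1 - a)\<^sup>2<..<r_bar a}"
    using half c0 by (auto simp: r_hat_def power2_eq_square)
  moreover have "equilibrium_profit1 a r < equilibrium_profit2 a r" if "r \<in> {r_hat<..r_bar a}" for r
  proof -
    have r: "1 / 2 < r" "r_bar a - 3 * c / 10 < r" "r \<le> r_bar a"
      using that by (auto simp: r_hat_def)
    define d where "d = 2 * (r_bar a - r) / 3"
    have d: "0 \<le> d" "d < c / 5"
      using r by (auto simp: d_def)
    have "0 \<le> z * d"
      using z0 d by simp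
    moreover have "a - a\<^sup>2 - (5 * (z + d) - (z + d)\<^sup>2) = c - 5 * d + 2 * (z * d) + d\<^sup>2"
      using root by (simp add: c_def power2_eq_square algebra_simps)
    ultimately have "5 * (z + d) - (z + d)\<^sup>2 \<le> a - a\<^sup>2"
      using d zero_le_power2[of d] by linarith
    moreover have "3 * (z + d) = 2 - a - 2 * r"
      by (simp add: d_def z_def field_simps)
    moreover have "r \<le> 1" "0 < z + d"
      using a r(3) d z0 rb by (simp_all add: field_simps)
    ultimately show ?thesis
      using a r by (intro profit1_less_corner[of a r "z + d"])
  qed
  ultimately show ?thesis
    by blast
qed

theorem proposition4:
  fixes s a :: real
  assumes "0 < s" and "s < 1 / 8"
    and "a = 1 - sqrt (2 * s)"
  shows "(\<forall>r \<in> {0..(1 - a)\<^sup>2}. equilibrium_profit1 a r > equilibrium_profit2 a r) \<and>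
    (\<exists>r_hat \<in> {(1 - a)\<^sup>2<..<r_bar a}.
       \<forall>r \<in> {r_hat<..r_bar a}. equilibrium_profit1 a r < equilibrium_profit2 a r)"
proof -
  have "sqrt (2 * s) < 1 / 2"
    using assms by (intro real_less_lsqrt) (auto simp: power2_eq_square)
  then have "1 / 2 < a" "a < 1"
    using assms by auto
  then show ?thesis
    using profit1_greater profit1_less_near_r_bar by auto
qed

end
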